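(* For every integer $n\ge3$, there is no non-constant $\varphi\in H^\infty_1(\mathbb{D}^n)$ such that the de Branges-Rovnyak space $\mathcal{H}(\mathcal{S}_n^\varphi)$ corresponding to the Szegő kernel $\mathcal{S}_n$ on $\mathbb{D}^n$ is a CNP space.
   Context: $\mathbb{D}$ is the open unit disc in $\mathbb{C}$. $H^\infty_1(\mathbb{D}^n)$ is the set of holomorphic functions $\varphi:\mathbb{D}^n\to\mathbb{C}$ with $\sup|\varphi|\le1$. The Szegő kernel (the kernel of the Hardy space $H^2(\mathbb{D}^n)$) is $$\mathcal{S}_n(\boldsymbol z,\boldsymbol w)=\frac{1}{\prod_{i=1}^n(1-z_i\overline{w_i})}\quad(\boldsymbol z,\boldsymbol w\in\mathbb{D}^n).$$ The space $\mathcal{H}(\mathcal{S}_n^\varphi)$ is the reproducing kernel Hilbert space on $\mathbb{D}^n$ with kernel $\mathcal{S}_n^\varphi(\boldsymbol z,\boldsymbol w)=(1-\varphi(\boldsymbol z)\overline{\varphi(\boldsymbol w)})\,\mathcal{S}_n(\boldsymbol z,\boldsymbol w)$. A kernel (positive semi-definite function) $K$ on a set $\Omega$, with reproducing kernel Hilbert space $\mathcal{H}(K)$, is a complete Nevanlinna-Pick (CNP) kernel, and $\mathcal{H}(K)$ a CNP space, if for all $m,l\in\mathbb{N}$, every finite set of distinct points $x_1,\dots,x_k\in\Omega$ and all complex $m\times l$ matrices $W_1,\dots,W_k$ for which the block matrix $[(I-W_iW_j^* )K(x_i,x_j)]_{i,j=1}^k$ is positive semi-definite, there is a function $\Phi$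 from $\Omega$ to the $m\times l$ matrices, multiplying $\mathcal{H}(K)\otimes\mathbb{C}^l$ into $\mathcal{H}(K)\otimes\mathbb{C}^m$, with $\Phi(x_i)=W_i$ for all $i$ and multiplication operator satisfying $\|M_\Phi\|\le1$. *)

theory Defs
  imports "HOL-Analysis.Analysis" "Jordan_Normal_Form.Schur_Decomposition"
begin

(* Both HOL-Analysis and Jordan_Normal_Form use the dollar sign for vector components;
   here it denotes the components of points of C^n. *)
no_notation Matrix.vec_index (infixl "$" 100)

section \<open>Bounded holomorphic functions on the polydisc\<close>

definition polydisc :: "(complex ^ 'n) set" where
  "polydisc = {z. \<forall>i. cmod (z $ i) < 1}"

text \<open>Holomorphy in several variables: the Frechet derivative exists at every point and is
  complex linear.\<close>

definition holomorphic_multi :: "(complex ^ 'n \<Rightarrow> complex) \<Rightarrow> (complex ^ 'n) set \<Rightarrow> bool" where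
  "holomorphic_multi f U \<longleftrightarrow>
     (\<forall>z\<in>U. \<exists>f'. (f has_derivative f') (at z) \<and> (\<forall>c v. f' (c *s v) = c * f' v))"

definition H_infinity_ball :: "(complex ^ 'n \<Rightarrow> complex) set" where
  "H_infinity_ball = {\<phi>. holomorphic_multi \<phi> polydisc \<and> (\<forall>z\<in>polydisc. cmod (\<phi> z) \<le> 1)}"

definition szego_kernel :: "complex ^ 'n \<Rightarrow> complex ^ 'n \<Rightarrow> complex" where
  "szego_kernel z w = 1 / (\<Prod>i\<in>UNIV. (1 - z $ i * cnj (w $ i)))"

definition dbr_kernel :: "(complex ^ 'n \<Rightarrow> complex) \<Rightarrow> complex ^ 'n \<Rightarrow> complex ^ 'n \<Rightarrow> complex" where
  "dbr_kernel \<phi> z w = (1 - \<phi> z * cnj (\<phi> w)) * szego_kernel z w"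

section \<open>Reproducing kernel Hilbert spaces\<close>

text \<open>In the order on the complex numbers used here, \<open>0 \<le> c\<close> says that \<open>c\<close> is real and
  nonnegative, so a positive semidefinite matrix is automatically Hermitian.\<close>

definition psd_mat :: "complex mat \<Rightarrow> bool" where
  "psd_mat A \<longleftrightarrow> dim_row A = dim_col A \<and>
     (\<forall>v \<in> carrier_vec (dim_row A). 0 \<le> (A *\<^sub>v v) \<bullet>c v)"

definition psd_kernel :: "'a set \<Rightarrow> ('a \<Rightarrow> 'a \<Rightarrow> complex) \<Rightarrow> bool" where
  "psd_kernel \<Omega> K \<longleftrightarrow>
     (\<forall>k (x :: nat \<Rightarrow> 'a). x ` {..<k} \<subseteq> \<Omega> \<longrightarrow>
        psd_mat (mat k k (\<lambda>(i, j). K (x i) (x j))))"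

text \<open>A Hilbert space of complex functions on \<open>\<Omega>\<close>, with inner product \<open>ip\<close> linear in the first
  argument. A function on \<open>\<Omega>\<close> is represented by its extension by zero to the whole type; the
  values of \<open>ip\<close> outside \<open>H\<close> are irrelevant.\<close>

locale hilbert_function_space =
  fixes \<Omega> :: "'a set"
    and H :: "('a \<Rightarrow> complex) set"
    and ip :: "('a \<Rightarrow> complex) \<Rightarrow> ('a \<Rightarrow> complex) \<Rightarrow> complex"
  assumes zero_outside: "f \<in> H \<Longrightarrow> x \<notin> \<Omega> \<Longrightarrow> f x = 0"
    and zero_mem: "(\<lambda>x. 0) \<in> H"
    and add_mem: "f \<in> H \<Longrightarrow> g \<in> H \<Longrightarrow> (\<lambda>x. f x + g x) \<in> H"
    and scale_mem: "f \<in> H \<Longrightarrow> (\<lambda>x. c * f x) \<in> H"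
    and ip_add: "f \<in> H \<Longrightarrow> g \<in> H \<Longrightarrow> h \<in> H \<Longrightarrow> ip (\<lambda>x. f x + g x) h = ip f h + ip g h"
    and ip_scale: "f \<in> H \<Longrightarrow> g \<in> H \<Longrightarrow> ip (\<lambda>x. c * f x) g = c * ip f g"
    and ip_cnj: "f \<in> H \<Longrightarrow> g \<in> H \<Longrightarrow> ip g f = cnj (ip f g)"
    and ip_nonneg: "f \<in> H \<Longrightarrow> 0 \<le> Re (ip f f)"
    and ip_definite: "f \<in> H \<Longrightarrow> ip f f = 0 \<Longrightarrow> f = (\<lambda>x. 0)"
    and complete:
      "(\<And>n. F n \<in> H) \<Longrightarrow>
       (\<And>e. e > 0 \<Longrightarrow> \<exists>N. \<forall>m\<ge>N. \<forall>n\<ge>N.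
          sqrt (Re (ip (\<lambda>x. F m x - F n x) (\<lambda>x. F m x - F n x))) < e) \<Longrightarrow>
       \<exists>f\<in>H. (\<lambda>n. sqrt (Re (ip (\<lambda>x. F n x - f x) (\<lambda>x. F n x - f x)))) \<longlonglongrightarrow> 0"

definition kernel_section :: "'a set \<Rightarrow> ('a \<Rightarrow> 'a \<Rightarrow> complex) \<Rightarrow> 'a \<Rightarrow> 'a \<Rightarrow> complex" where
  "kernel_section \<Omega> K w = (\<lambda>z. if z \<in> \<Omega> then K z w else 0)"

locale rkhs = hilbert_function_space +
  fixes K :: "'a \<Rightarrow> 'a \<Rightarrow> complex"
  assumes section_mem: "w \<in> \<Omega> \<Longrightarrow> kernel_section \<Omega> K w \<in> H"
    and reproducing: "w \<in> \<Omega> \<Longrightarrow> f \<in> H \<Longrightarrow> f w = ip f (kernel_section \<Omega> K w)"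

section \<open>Complete Nevanlinna-Pick spaces\<close>

text \<open>The Hilbert space tensor product of \<open>H\<close> with \<open>C^l\<close>, as the space of \<open>C^l\<close>-valued functions
  whose components belong to \<open>H\<close>, and the square of its norm.\<close>

definition tensor_space :: "('a \<Rightarrow> complex) set \<Rightarrow> nat \<Rightarrow> ('a \<Rightarrow> complex Matrix.vec) set" where
  "tensor_space H l =
     {F. (\<forall>x. F x \<in> carrier_vec l) \<and> (\<forall>j<l. (\<lambda>x. vec_index (F x) j) \<in> H)}"

definition tensor_norm_sq ::
  "(('a \<Rightarrow> complex) \<Rightarrow> ('a \<Rightarrow> complex) \<Rightarrow> complex) \<Rightarrow> nat \<Rightarrow> ('a \<Rightarrow> complex Matrix.vec) \<Rightarrow> real" where
  "tensor_norm_sq ip l F =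
     (\<Sum>j<l. Re (ip (\<lambda>x. vec_index (F x) j) (\<lambda>x. vec_index (F x) j)))"

definition mult_op ::
  "'a set \<Rightarrow> nat \<Rightarrow> ('a \<Rightarrow> complex mat) \<Rightarrow> ('a \<Rightarrow> complex Matrix.vec) \<Rightarrow> 'a \<Rightarrow> complex Matrix.vec" where
  "mult_op \<Omega> m \<Phi> F = (\<lambda>x. if x \<in> \<Omega> then \<Phi> x *\<^sub>v F x else 0\<^sub>v m)"

definition contractive_multiplier ::
  "'a set \<Rightarrow> ('a \<Rightarrow> complex) set \<Rightarrow> (('a \<Rightarrow> complex) \<Rightarrow> ('a \<Rightarrow> complex) \<Rightarrow> complex) \<Rightarrow>
   nat \<Rightarrow> nat \<Rightarrow> ('a \<Rightarrow> complex mat) \<Rightarrow> bool" where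
  "contractive_multiplier \<Omega> H ip m l \<Phi> \<longleftrightarrow>
     \<Phi> \<in> \<Omega> \<rightarrow> carrier_mat m l \<and>
     (\<forall>F \<in> tensor_space H l.
        mult_op \<Omega> m \<Phi> F \<in> tensor_space H m \<and>
        tensor_norm_sq ip m (mult_op \<Omega> m \<Phi> F) \<le> tensor_norm_sq ip l F)"

text \<open>The \<open>k\<times>k\<close> block matrix with \<open>m\<times>m\<close> blocks \<open>(I - W\<^sub>i W\<^sub>j\<^sup>*) K(x\<^sub>i, x\<^sub>j)\<close>; the flat index
  \<open>r < k * m\<close> stands for row \<open>r mod m\<close> of block row \<open>r div m\<close>, and likewise for columns.\<close>

definition pick_matrix ::
  "('a \<Rightarrow> 'a \<Rightarrow> complex) \<Rightarrow> nat \<Rightarrow> nat \<Rightarrow> (nat \<Rightarrow> 'a) \<Rightarrow> (nat \<Rightarrow> complex mat) \<Rightarrow> complex mat" where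
  "pick_matrix K m k x W =
     mat (k * m) (k * m) (\<lambda>(r, c).
       (1\<^sub>m m - W (r div m) * mat_adjoint (W (c div m))) $$ (r mod m, c mod m)
         * K (x (r div m)) (x (c div m)))"

definition cnp_space ::
  "'a set \<Rightarrow> ('a \<Rightarrow> complex) set \<Rightarrow> (('a \<Rightarrow> complex) \<Rightarrow> ('a \<Rightarrow> complex) \<Rightarrow> complex) \<Rightarrow>
   ('a \<Rightarrow> 'a \<Rightarrow> complex) \<Rightarrow> bool" where
  "cnp_space \<Omega> H ip K \<longleftrightarrow>
     psd_kernel \<Omega> K \<and> rkhs \<Omega> H ip K \<and>
     (\<forall>m>0. \<forall>l>0. \<forall>k x W.
        x ` {..<k} \<subseteq> \<Omega> \<and> inj_on x {..<k} \<and> (\<forall>i<k. W i \<in> carrier_mat m l) \<and>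
        psd_mat (pick_matrix K m k x W) \<longrightarrow>
        (\<exists>\<Phi>. contractive_multiplier \<Omega> H ip m l \<Phi> \<and> (\<forall>i<k. \<Phi> (x i) = W i)))"

end

theory Submission
  imports Defs "HOL-Complex_Analysis.Complex_Analysis"
begin

text \<open>If \<open>K\<close> is a CNP kernel, then \<open>L z w = 1 - K z 0 * K 0 w / (K 0 0 * K z w)\<close> is positive
  semidefinite. For the de Branges-Rovnyak kernel,
  \<open>L z w = 1 - (\<Prod>i. 1 - z\<^sub>i cnj w\<^sub>i) / (1 - \<beta> z * cnj (\<beta> w))\<close>, where \<open>\<beta>\<close> is \<open>\<phi>\<close> followed by the
  Moebius map that moves \<open>\<phi> 0\<close> to the origin. When \<open>n \<ge> 3\<close>, the derivative of \<open>\<phi>\<close> at the origin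
  annihilates a vector \<open>v\<close> with exactly two nonzero coordinates \<open>x\<close> and \<open>y\<close>. On the line through \<open>v\<close>
  we then have \<open>\<beta> (h v) = o(h)\<close>, and the sum of \<open>L\<close> over the four pairs from \<open>{h v, - h v}\<close> is at
  most \<open>- 4 \<bar>x\<bar>\<^sup>2 \<bar>y\<bar>\<^sup>2 h\<^sup>4 + o(h\<^sup>4)\<close>, a contradiction.\<close>

section \<open>Inner products, Cauchy-Schwarz and scalar multipliers\<close>

context hilbert_function_space
begin

lemma ip_linear_right:
  assumes f: "f \<in> H" and g: "g \<in> H" and h: "h \<in> H"
  shows "ip h (\<lambda>x. f x + c * g x) = ip h f + cnj c * ip h g"
proof -
  have cg: "(\<lambda>x. c * g x) \<in> H" using g by (rule scale_mem)
  have s: "(\<lambda>x. f x + c * g x) \<in> H" using f cg by (rule add_mem)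
  show ?thesis
    using ip_cnj[OF s h] ip_cnj[OF f h] ip_cnj[OF g h] ip_add[OF f cg h] ip_scale[OF g h]
    by simp
qed

lemma ip_norm_expand:
  assumes f: "f \<in> H" and g: "g \<in> H"
  shows "Re (ip (\<lambda>x. f x + c * g x) (\<lambda>x. f x + c * g x)) =
    Re (ip f f) + 2 * Re (cnj c * ip f g) + (cmod c)\<^sup>2 * Re (ip g g)"
proof -
  have cg: "(\<lambda>x. c * g x) \<in> H" using g by (rule scale_mem)
  have s: "(\<lambda>x. f x + c * g x) \<in> H" using f cg by (rule add_mem)
  note right = ip_linear_right[OF f g, of _ c]
  have "Re (ip f (\<lambda>x. f x + c * g x)) = Re (ip f f) + Re (cnj c * ip f g)"
    by (simp add: right f)
  moreover have gf: "ip g f = cnj (ip f g)"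
    using f g by (rule ip_cnj)
  have "Re (c * ip g (\<lambda>x. f x + c * g x)) =
      Re (cnj c * ip f g) + Re (c * cnj c * ip g g)"
    by (simp add: right g gf algebra_simps)
  moreover have "Re (c * cnj c * ip g g) = (cmod c)\<^sup>2 * Re (ip g g)"
    by (simp only: complex_norm_square[symmetric]) simp
  ultimately show ?thesis
    by (simp add: ip_add[OF f cg s] ip_scale[OF g s])
qed

lemma ip_self: "f \<in> H \<Longrightarrow> ip f f = complex_of_real (Re (ip f f))"
  using ip_cnj[of f f] by (simp add: complex_eq_iff)

lemma Cauchy_Schwarz:
  assumes f: "f \<in> H" and g: "g \<in> H"
  shows "(cmod (ip f g))\<^sup>2 \<le> Re (ip f f) * Re (ip g g)"
proof (cases "ip g g = 0")
  case True
  then have "g = (\<lambda>x. 0)" using g ip_definite by blast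
  then have "ip g f = 0" using ip_scale[OF g f, of 0] by simp
  then show ?thesis using ip_cnj[OF g f] True by simp
next
  case False
  then have pos: "Re (ip g g) > 0"
    using ip_nonneg[OF g] ip_self[OF g] by (metis less_eq_real_def of_real_0)
  define r where "r = Re (ip g g)"
  define c where "c = - ip f g / complex_of_real r"
  have "(\<lambda>x. f x + c * g x) \<in> H" using f g by (intro add_mem scale_mem)
  from ip_nonneg[OF this]
  have "0 \<le> Re (ip f f) + 2 * Re (cnj c * ip f g) + (cmod c)\<^sup>2 * r"
    unfolding ip_norm_expand[OF f g] r_def .
  moreover have "cnj c * ip f g = - (ip f g * cnj (ip f g)) / complex_of_real r"
    by (simp add: c_def mult.commute)
  then have "cnj c * ip f g = complex_of_real (- (cmod (ip f g))\<^sup>2 / r)"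
    by (simp only: complex_norm_square[symmetric] of_real_minus of_real_divide)
  then have "Re (cnj c * ip f g) = - (cmod (ip f g))\<^sup>2 / r"
    by (simp only: Re_complex_of_real)
  moreover have "(cmod c)\<^sup>2 * r = (cmod (ip f g))\<^sup>2 / r"
    using pos by (simp add: c_def r_def norm_divide power_divide power2_eq_square)
  ultimately have "0 \<le> Re (ip f f) - (cmod (ip f g))\<^sup>2 / r" by simp
  then show ?thesis using pos by (simp add: r_def field_simps)
qed

text \<open>Unpacks the matrix-valued notion for \<open>m = l = 1\<close>, so that later arguments
  deal with products of scalar functions only.\<close>

lemma scalar_contractive_multiplier:
  assumes \<Phi>: "contractive_multiplier \<Omega> H ip 1 1 \<Phi>" and q: "q \<in> H"
  obtains g where "g \<in> H" "\<And>z. z \<in> \<Omega> \<Longrightarrow> g z = \<Phi> z $$ (0, 0) * q z" "Re (ip g g) \<le> Re (ip q q)"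
proof -
  define g where "g = (\<lambda>z. if z \<in> \<Omega> then \<Phi> z $$ (0, 0) * q z else 0)"
  define F where "F = (\<lambda>z. Matrix.vec 1 (\<lambda>_. q z))"
  have F: "F \<in> tensor_space H 1" using q by (simp add: tensor_space_def F_def)
  have "vec_index (mult_op \<Omega> 1 \<Phi> F z) 0 = g z" for z
    using \<Phi> by (auto simp: mult_op_def F_def g_def contractive_multiplier_def Pi_iff scalar_prod_def)
  then have eq: "(\<lambda>z. vec_index (mult_op \<Omega> 1 \<Phi> F z) 0) = g" by blast
  have "mult_op \<Omega> 1 \<Phi> F \<in> tensor_space H 1"
    and le: "tensor_norm_sq ip 1 (mult_op \<Omega> 1 \<Phi> F) \<le> tensor_norm_sq ip 1 F"
    using \<Phi> F by (auto simp: contractive_multiplier_def)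
  then have "g \<in> H" using eq by (auto simp: tensor_space_def)
  moreover have "Re (ip g g) \<le> Re (ip q q)"
    using le eq by (simp add: tensor_norm_sq_def F_def)
  ultimately show ?thesis by (intro that[of g]) (simp_all add: g_def)
qed

end

context rkhs
begin

lemma kernel_cnj: "z \<in> \<Omega> \<Longrightarrow> w \<in> \<Omega> \<Longrightarrow> K w z = cnj (K z w)"
  using reproducing[of z "kernel_section \<Omega> K w"] reproducing[of w "kernel_section \<Omega> K z"]
    ip_cnj[of "kernel_section \<Omega> K w" "kernel_section \<Omega> K z"] section_mem[of z] section_mem[of w]
  by (simp add: kernel_section_def)

lemma kernel_diag_nonneg: "z \<in> \<Omega> \<Longrightarrow> 0 \<le> Re (K z z)"
  using reproducing[of z "kernel_section \<Omega> K z"] ip_nonneg[OF section_mem[of z]] section_mem[of z]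
  by (simp add: kernel_section_def)

lemma kernel_diag: "z \<in> \<Omega> \<Longrightarrow> K z z = complex_of_real (Re (K z z))"
  using kernel_cnj[of z z] by (simp add: complex_eq_iff)

lemma kernel_Cauchy_Schwarz:
  assumes z: "z \<in> \<Omega>" and w: "w \<in> \<Omega>"
  shows "(cmod (K z w))\<^sup>2 \<le> Re (K z z) * Re (K w w)"
  using Cauchy_Schwarz[OF section_mem[OF w] section_mem[OF z]]
    reproducing[OF z section_mem[OF w]] reproducing[OF z section_mem[OF z]]
    reproducing[OF w section_mem[OF w]] z w
  by (simp add: kernel_section_def mult.commute)

end

section \<open>From interpolation to positivity at three points\<close>

lemma psd_mat_rank_one_2:
  assumes "r \<ge> 0"
    and A: "A = mat 2 2 (\<lambda>(i, j). complex_of_real r * u i * cnj (u j))"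
  shows "psd_mat A"
  unfolding psd_mat_def
proof (intro conjI ballI)
  fix v :: "complex Matrix.vec"
  assume "v \<in> carrier_vec (dim_row A)"
  then have v: "dim_vec v = 2" by (simp add: A)
  define s where "s = cnj (u 0) * vec_index v 0 + cnj (u 1) * vec_index v 1"
  have "(A *\<^sub>v v) \<bullet>c v = complex_of_real r * (s * cnj s)"
    by (simp add: A scalar_prod_def v numeral_2_eq_2 s_def algebra_simps)
  also have "\<dots> = complex_of_real (r * (cmod s)\<^sup>2)"
    by (simp only: complex_norm_square of_real_mult)
  finally show "0 \<le> (A *\<^sub>v v) \<bullet>c v"
    using \<open>r \<ge> 0\<close> by (simp add: less_eq_complex_def)
qed (simp add: A)

text \<open>The target at \<open>y\<close> is extremal: it makes the determinant of the Pick matrix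
  vanish. That matrix then has rank one, built from the column \<open>K x x\<close>,
  \<open>K y x\<close>, and is therefore positive semidefinite.\<close>

lemma scalar_two_point_interpolation:
  assumes cnp: "cnp_space \<Omega> H ip K" and x: "x \<in> \<Omega>" and y: "y \<in> \<Omega>" and "x \<noteq> y"
    and pos: "Re (K x x) > 0" "Re (K y y) > 0"
  obtains \<Phi> where "contractive_multiplier \<Omega> H ip 1 1 \<Phi>" "\<Phi> x $$ (0, 0) = 0"
    "(cmod (\<Phi> y $$ (0, 0)))\<^sup>2 = 1 - (cmod (K x y))\<^sup>2 / (Re (K x x) * Re (K y y))"
proof -
  interpret rkhs \<Omega> H ip K using cnp by (simp add: cnp_space_def)
  define w where "w = sqrt (1 - (cmod (K x y))\<^sup>2 / (Re (K x x) * Re (K y y)))"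
  have w2: "w\<^sup>2 = 1 - (cmod (K x y))\<^sup>2 / (Re (K x x) * Re (K y y))"
    unfolding w_def using kernel_Cauchy_Schwarz[OF x y] pos by (simp add: field_simps)
  define W where "W = (\<lambda>i::nat. mat 1 1 (\<lambda>_. if i = 0 then 0 else complex_of_real w))"
  define p where "p = (\<lambda>i::nat. if i = 0 then x else y)"
  have Wadj: "mat_adjoint (W i) = W i" for i
    by (rule eq_matI) (auto simp: W_def mat_adjoint_def mat_of_rows_def)
  \<comment> \<open>This is the vanishing of the determinant, solved for the lower right
    entry.\<close>
  have yy: "(1 - complex_of_real w * complex_of_real w) * K y y =
      K y x * cnj (K y x) / complex_of_real (Re (K x x))"
  proof -
    have "(1 - complex_of_real w * complex_of_real w) * K y y =
      complex_of_real ((1 - w\<^sup>2) * Re (K y y))"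
      by (subst kernel_diag[OF y]) (simp add: power2_eq_square)
    also have "(1 - w\<^sup>2) * Re (K y y) = (cmod (K y x))\<^sup>2 / Re (K x x)"
      using pos by (simp add: w2 kernel_cnj[OF x y])
    finally show ?thesis by (simp only: complex_norm_square of_real_divide)
  qed
  have "psd_mat (pick_matrix K 1 2 p W)"
  proof (rule psd_mat_rank_one_2)
    show "0 \<le> 1 / Re (K x x)" using pos by simp
    show "pick_matrix K 1 2 p W = mat 2 2 (\<lambda>(i, j). complex_of_real (1 / Re (K x x)) *
        (\<lambda>i. K (p i) x) i * cnj ((\<lambda>i. K (p i) x) j))"
    proof (rule eq_matI; clarsimp simp: pick_matrix_def Wadj)
      fix i j :: nat assume ij: "i < 2" "j < 2"
      show "(1\<^sub>m (Suc 0) - W i * W j) $$ (0, 0) * K (p i) (p j) =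
        K (p i) x * cnj (K (p j) x) / complex_of_real (Re (K x x))"
        using ij pos yy kernel_diag[OF x] kernel_cnj[OF x y] kernel_cnj[OF x x]
        by (auto simp: less_2_cases_iff W_def p_def scalar_prod_def)
    qed
  qed
  moreover have "p ` {..<2} \<subseteq> \<Omega>" "inj_on p {..<2}" "\<forall>i<2. W i \<in> carrier_mat 1 1"
    using x y \<open>x \<noteq> y\<close> by (auto simp: p_def inj_on_def W_def less_2_cases_iff)
  ultimately have "\<exists>\<Phi>. contractive_multiplier \<Omega> H ip 1 1 \<Phi> \<and> (\<forall>i<2. \<Phi> (p i) = W i)"
    by (intro cnp[unfolded cnp_space_def, THEN conjunct2, THEN conjunct2, rule_format])
      (simp_all del: One_nat_def)
  then obtain \<Phi> where "contractive_multiplier \<Omega> H ip 1 1 \<Phi>"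
    and \<Phi>: "\<forall>i<2. \<Phi> (p i) = W i"
    by blast
  moreover have "\<Phi> x = W 0" "\<Phi> y = W 1"
    using \<Phi>[rule_format, of 0] \<Phi>[rule_format, of 1] by (simp_all add: p_def)
  ultimately show ?thesis using w2
    by (intro that[of \<Phi>]) (simp_all add: W_def norm_power flip: of_real_power)
qed


text \<open>This is the necessity half of the McCullough-Quiggin theorem for three points. The multiplier
  \<open>\<Phi>\<close> solves the extremal two-point problem \<open>x \<mapsto> 0\<close>, \<open>y \<mapsto> w\<close>; it acts contractively on the
  subspace of functions vanishing at \<open>a\<close>, whose reproducing kernel is \<open>Q\<close>, and
  \<open>1 - K z a K a w / (K a a K z w)\<close> equals \<open>Q z w / K z w\<close>.\<close>

lemma cnp_three_points:
  assumes cnp: "cnp_space \<Omega> H ip K" and a: "a \<in> \<Omega>" and x: "x \<in> \<Omega>" and y: "y \<in> \<Omega>"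
    and "x \<noteq> y"
    and pos: "Re (K a a) > 0" "Re (K x x) > 0" "Re (K y y) > 0" and xy: "K x y \<noteq> 0"
    and L: "\<And>z w. L z w = 1 - K z a * K a w / (K a a * K z w)"
  shows "0 \<le> Re (L x x + L x y + L y x + L y y)"
proof -
  interpret rkhs \<Omega> H ip K using cnp by (simp add: cnp_space_def)
  define Q where "Q = (\<lambda>z w. K z w - K z a * K a w / K a a)"
  \<comment> \<open>\<open>q v\<close> is the projection of the kernel section at \<open>v\<close>
    onto the functions vanishing at \<open>a\<close>; on that subspace it represents evaluation at
    \<open>v\<close> (see \<open>rep\<close>).\<close>
  define q where "q = (\<lambda>v z. kernel_section \<Omega> K v z + (- K a v / K a a) * kernel_section \<Omega> K a z)"
  have Kaa: "K a a \<noteq> 0" using pos by auto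
  have LQ: "L z w = Q z w / K z w" if "K z w \<noteq> 0" for z w
    using that Kaa by (simp add: L Q_def divide_simps)
  have q: "q v \<in> H" if "v \<in> \<Omega>" for v
    unfolding q_def using that a by (intro add_mem scale_mem section_mem)
  have qQ: "q v z = Q z v" if "z \<in> \<Omega>" for v z
    using that by (simp add: q_def Q_def kernel_section_def)
  have q0: "q v a = 0" for v
    using a Kaa by (simp add: qQ Q_def)
  have rep: "ip f (q v) = f v" if "f \<in> H" "f a = 0" "v \<in> \<Omega>" for f v
    unfolding q_def using that a
    by (simp only: ip_linear_right[OF section_mem section_mem] reproducing[symmetric]) simp
  have ipq: "ip (q v) (q w) = Q w v" if "v \<in> \<Omega>" "w \<in> \<Omega>" for v w
    using rep[OF q q0] that by (simp add: qQ)
  have Qnonneg: "0 \<le> Re (Q v v)" if "v \<in> \<Omega>" for v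
    using ip_nonneg[OF q] ipq that by metis
  have Qreal: "Q v v = complex_of_real (Re (Q v v))" if "v \<in> \<Omega>" for v
    using ip_self[OF q] ipq that by metis
  have Lreal: "Re (L v v) = Re (Q v v) / Re (K v v)" if "v \<in> \<Omega>" "Re (K v v) > 0" for v
  proof -
    have "L v v = complex_of_real (Re (Q v v)) / complex_of_real (Re (K v v))"
      using that LQ[of v v] Qreal[of v] kernel_diag[of v] by fastforce
    then show ?thesis by (simp flip: of_real_divide)
  qed
  have Lyx: "L y x = cnj (L x y)"
    using kernel_cnj[OF x y] kernel_cnj[OF a x] kernel_cnj[OF a y] kernel_cnj[OF a a]
    by (simp add: L mult.commute)
  define k where "k = (cmod (K x y))\<^sup>2"
  have k: "k > 0" using xy by (simp add: k_def)
  \<comment> \<open>With this coefficient in the test function \<open>e = q y + c * q x\<close>, all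
    terms of the final inequality share the factor \<open>k / Re (K x x)\<close>, and what remains
    is the sum of the entries of \<open>L\<close>.\<close>
  define c where "c = K x y / K x x"
  have cnjc: "cnj c = cnj (K x y) / complex_of_real (Re (K x x))"
    using kernel_diag[OF x] kernel_cnj[OF x x] by (simp add: c_def)
  have "cnj c * Q x y = (K x y * cnj (K x y)) * L x y / complex_of_real (Re (K x x))"
    using xy by (simp add: LQ cnjc)
  also have "\<dots> = complex_of_real (k / Re (K x x)) * L x y"
    unfolding complex_norm_square[symmetric] k_def by simp
  finally have cross: "Re (cnj c * Q x y) = k / Re (K x x) * Re (L x y)"
    by simp
  have "cmod (K x x) = Re (K x x)"
    by (subst kernel_diag[OF x]) (use pos in simp)
  then have c2: "(cmod c)\<^sup>2 = k / (Re (K x x))\<^sup>2"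
    by (simp add: c_def k_def norm_divide power_divide)
  define E where "E = Re (Q y y) + 2 * Re (cnj c * Q x y) + (cmod c)\<^sup>2 * Re (Q x x)"
  define e where "e = (\<lambda>z. q y z + c * q x z)"
  have e: "e \<in> H" unfolding e_def using q x y by (intro add_mem scale_mem)
  have E: "Re (ip e e) = E"
    unfolding e_def E_def using ip_norm_expand[OF q[OF y] q[OF x], of c] x y by (simp add: ipq)
  show ?thesis
  \<comment> \<open>The main argument divides by \<open>Re (Q y y)\<close>. If this vanishes, then
    \<open>q y = 0\<close>, hence \<open>L x y = 0\<close>, and only nonnegative diagonal terms are
    left.\<close>
  proof (cases "Re (Q y y) = 0")
    case True
    then have "q y = (\<lambda>z. 0)"
      using ip_definite[OF q[OF y]] ipq[OF y y] Qreal[OF y] by simp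
    then have "Q x y = 0" using qQ[OF x, of y] by simp
    then have "L x y = 0" using LQ xy by simp
    then show ?thesis
      using Lyx Lreal[OF x pos(2)] Lreal[OF y pos(3)] Qnonneg[OF x] pos True by simp
  next
    case False
    then have Qyy: "Re (Q y y) > 0" using Qnonneg[OF y] by simp
    obtain \<Phi> where \<Phi>: "contractive_multiplier \<Omega> H ip 1 1 \<Phi>" "\<Phi> x $$ (0, 0) = 0"
      and w: "(cmod (\<Phi> y $$ (0, 0)))\<^sup>2 = 1 - k / (Re (K x x) * Re (K y y))"
      using scalar_two_point_interpolation[OF cnp x y \<open>x \<noteq> y\<close> pos(2,3)] unfolding k_def by blast
    obtain g where g: "g \<in> H" and gz: "\<And>z. z \<in> \<Omega> \<Longrightarrow> g z = \<Phi> z $$ (0, 0) * q y z"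
      and gle: "Re (ip g g) \<le> Re (ip (q y) (q y))"
      using scalar_contractive_multiplier[OF \<Phi>(1) q[OF y]] by blast
    \<comment> \<open>The product \<open>g\<close> inherits a zero at \<open>a\<close> from
      \<open>q y\<close> and one at \<open>x\<close> from \<open>\<Phi>\<close>, so its inner
      product with \<open>e\<close> sees only the value at \<open>y\<close>. Cauchy-Schwarz and
      contractivity then bound that value by \<open>E\<close>.\<close>
    have "g a = 0" "g x = 0" using gz a x q0 \<Phi>(2) by simp_all
    then have "ip g e = \<Phi> y $$ (0, 0) * Q y y"
      unfolding e_def using ip_linear_right[OF q[OF y] q[OF x] g, of c] g x y gz[OF y]
      by (simp add: rep qQ)
    moreover have "cmod (Q y y) = Re (Q y y)"
      by (subst Qreal[OF y]) (use Qyy in simp)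
    ultimately have "(cmod (ip g e))\<^sup>2 = (cmod (\<Phi> y $$ (0, 0)))\<^sup>2 * (Re (Q y y))\<^sup>2"
      by (simp add: norm_mult power_mult_distrib)
    moreover have "(cmod (ip g e))\<^sup>2 \<le> Re (Q y y) * E"
      using Cauchy_Schwarz[OF g e] gle ip_nonneg[OF e] E ipq[OF y y]
      by (metis (no_types, lifting) mult_right_mono order_trans)
    ultimately have "(cmod (\<Phi> y $$ (0, 0)))\<^sup>2 * Re (Q y y) \<le> E"
      using Qyy by (simp add: power2_eq_square mult.left_commute)
    then have "0 \<le> k / (Re (K x x) * Re (K y y)) * Re (Q y y)
        + 2 * (k / Re (K x x) * Re (L x y)) + k / (Re (K x x))\<^sup>2 * Re (Q x x)"
      unfolding w E_def cross c2 by (simp add: algebra_simps)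
    also have "\<dots> = k / Re (K x x) * (Re (L y y) + 2 * Re (L x y) + Re (L x x))"
      using pos by (simp add: Lreal x y field_simps power2_eq_square)
    finally show ?thesis
      using k pos Lyx by (simp add: zero_le_mult_iff zero_le_divide_iff)
  qed
qed

section \<open>Fourth-order estimate of the four-point sum\<close>

text \<open>Expand the geometric series to second order and split \<open>A * d\<close> as
  \<open>d + (A - 1) * d\<close>. The term \<open>d\<close> is kept exactly, because over four
  points these terms add up to a square; the rest is small when \<open>A\<close> is near 1. The
  factor 2 comes from \<open>cmod (1 - d) \<ge> 1 / 2\<close>.\<close>

lemma Re_quotient_lower_bound:
  assumes "0 \<le> A" and d: "cmod d \<le> 1 / 2"
  shows "A + Re d - (\<bar>A - 1\<bar> * cmod d + 2 * A * (cmod d)\<^sup>2) \<le> Re (complex_of_real A / (1 - d))"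
proof -
  have d1: "1 / 2 \<le> cmod (1 - d)"
    using norm_triangle_ineq2[of 1 d] d by simp
  then have "1 - d \<noteq> 0" by auto
  then have "complex_of_real A / (1 - d) =
      of_real A + d + of_real (A - 1) * d + of_real A * d\<^sup>2 / (1 - d)"
    by (simp add: field_simps power2_eq_square)
  then have "Re (complex_of_real A / (1 - d)) =
      A + Re d + Re (of_real (A - 1) * d) + Re (of_real A * d\<^sup>2 / (1 - d))"
    by simp
  moreover have "\<bar>Re (of_real (A - 1) * d)\<bar> \<le> \<bar>A - 1\<bar> * cmod d"
    by (metis abs_Re_le_cmod norm_mult norm_of_real)
  moreover have "\<bar>Re (of_real A * d\<^sup>2 / (1 - d))\<bar> \<le> 2 * A * (cmod d)\<^sup>2"
  proof -
    have "\<bar>Re (of_real A * d\<^sup>2 / (1 - d))\<bar> \<le> A * (cmod d)\<^sup>2 / cmod (1 - d)"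
      using abs_Re_le_cmod[of "of_real A * d\<^sup>2 / (1 - d)"] \<open>0 \<le> A\<close>
      by (simp add: norm_divide norm_mult norm_power)
    also have "\<dots> \<le> A * (cmod d)\<^sup>2 / (1 / 2)"
      using d1 \<open>0 \<le> A\<close> by (intro divide_left_mono) auto
    finally show ?thesis by simp
  qed
  ultimately show ?thesis by linarith
qed

text \<open>The excess comes from \<open>A + B = 2 + 2 p q h\<^sup>4\<close>; since \<open>\<beta>\<close> and \<open>\<gamma>\<close> are \<open>o(h)\<close>, they contribute
  only the nonnegative term \<open>\<bar>\<beta> + \<gamma>\<bar>\<^sup>2\<close> and an error \<open>o(h\<^sup>4)\<close>.\<close>

lemma four_point_sum_gt:
  fixes p q h e :: real and \<beta> \<gamma> :: complex
  assumes p: "0 < p" and q: "0 < q" and h: "0 < h" "h \<le> 1" "p * h\<^sup>2 \<le> 1" "q * h\<^sup>2 \<le> 1"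
    and e: "0 < e" "e \<le> 1 / 2" "(p + q + p * q + 8) * e\<^sup>2 < p * q"
    and \<beta>: "cmod \<beta> \<le> e * h" and \<gamma>: "cmod \<gamma> \<le> e * h"
    and A: "A = (1 - p * h\<^sup>2) * (1 - q * h\<^sup>2)" and B: "B = (1 + p * h\<^sup>2) * (1 + q * h\<^sup>2)"
  shows "4 < Re (of_real A / (1 - \<beta> * cnj \<beta>) + of_real B / (1 - \<beta> * cnj \<gamma>)
    + of_real B / (1 - \<gamma> * cnj \<beta>) + of_real A / (1 - \<gamma> * cnj \<gamma>))"
proof -
  \<comment> \<open>\<open>C * h\<^sup>2\<close> bounds the distance of both \<open>A\<close> and
    \<open>B\<close> from 1, since \<open>h ^ 4 \<le> h\<^sup>2\<close>.\<close>
  define C where "C = p + q + p * q"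
  have C: "0 \<le> C" using p q by (simp add: C_def)
  have h2: "h\<^sup>2 \<le> 1" using h by (simp add: power_le_one)
  have e2: "e\<^sup>2 \<le> 1 / 4" using e power_mono[of e "1/2" 2] by (simp add: power2_eq_square)
  have pq: "p * q * (h\<^sup>2 * h\<^sup>2) \<le> p * q * h\<^sup>2"
    using p q h2 by (intro mult_left_mono mult_left_le_one_le) auto
  have "0 \<le> p * q * (h\<^sup>2 * h\<^sup>2)" using p q by simp
  note pq = pq this
  have AB: "0 \<le> A" "A \<le> 4" "\<bar>A - 1\<bar> \<le> C * h\<^sup>2" "0 \<le> B" "B \<le> 4" "\<bar>B - 1\<bar> \<le> C * h\<^sup>2"
  proof -
    have p0: "0 \<le> p * h\<^sup>2" "0 \<le> q * h\<^sup>2" using p q by simp_all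
    show "0 \<le> A" unfolding A using h by simp
    have "A \<le> 1 * 1" unfolding A using h p0 by (intro mult_mono) auto
    then show "A \<le> 4" by simp
    show "0 \<le> B" unfolding B using p0 by simp
    have "B \<le> 2 * 2" unfolding B using h p0 by (intro mult_mono) auto
    then show "B \<le> 4" by simp
    have "A - 1 = - (p * h\<^sup>2) - q * h\<^sup>2 + p * q * (h\<^sup>2 * h\<^sup>2)" by (simp add: A algebra_simps)
    moreover have "C * h\<^sup>2 = p * h\<^sup>2 + q * h\<^sup>2 + p * q * h\<^sup>2" by (simp add: C_def algebra_simps)
    moreover have "B - 1 = p * h\<^sup>2 + q * h\<^sup>2 + p * q * (h\<^sup>2 * h\<^sup>2)" by (simp add: B algebra_simps)
    ultimately show "\<bar>A - 1\<bar> \<le> C * h\<^sup>2" "\<bar>B - 1\<bar> \<le> C * h\<^sup>2" using p0 pq by linarith+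
  qed
  \<comment> \<open>The error allowed for each quotient: \<open>C\<close> accounts for the term with
    \<open>M - 1\<close>, and 8 for the quadratic term, where \<open>M \<le> 4\<close>.\<close>
  define r where "r = (C + 8) * e\<^sup>2 * h ^ 4"
  have bound: "M + Re (s * cnj t) - r \<le> Re (complex_of_real M / (1 - s * cnj t))"
    if M: "0 \<le> M" "M \<le> 4" "\<bar>M - 1\<bar> \<le> C * h\<^sup>2" and s: "cmod s \<le> e * h" and t: "cmod t \<le> e * h"
    for M s t
  proof -
    define d where "d = s * cnj t"
    have "cmod d \<le> (e * h) * (e * h)"
      unfolding d_def norm_mult using s t e h by (intro mult_mono) auto
    then have d: "cmod d \<le> e\<^sup>2 * h\<^sup>2" by (simp add: power2_eq_square algebra_simps)
    also have "\<dots> \<le> 1 / 4 * 1" using e2 h2 by (intro mult_mono) auto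
    finally have d2: "cmod d \<le> 1 / 2" by simp
    have "\<bar>M - 1\<bar> * cmod d \<le> (C * h\<^sup>2) * (e\<^sup>2 * h\<^sup>2)"
      using M d C by (intro mult_mono) auto
    moreover have "2 * M * (cmod d)\<^sup>2 \<le> 8 * (e\<^sup>2 * h\<^sup>2)\<^sup>2"
      using M d by (intro mult_mono power_mono) auto
    moreover have "(e\<^sup>2 * h\<^sup>2)\<^sup>2 \<le> e\<^sup>2 * h ^ 4"
    proof -
      have "(e\<^sup>2 * h\<^sup>2)\<^sup>2 = e\<^sup>2 * (e\<^sup>2 * h ^ 4)" by (simp add: power2_eq_square power4_eq_xxxx)
      also have "\<dots> \<le> 1 * (e\<^sup>2 * h ^ 4)" using e2 by (intro mult_right_mono) auto
      finally show ?thesis by simp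
    qed
    moreover have "r = (C * h\<^sup>2) * (e\<^sup>2 * h\<^sup>2) + 8 * (e\<^sup>2 * h ^ 4)"
      by (simp add: r_def power2_eq_square power4_eq_xxxx algebra_simps)
    ultimately have "\<bar>M - 1\<bar> * cmod d + 2 * M * (cmod d)\<^sup>2 \<le> r" by linarith
    then show ?thesis
      using Re_quotient_lower_bound[OF M(1) d2] unfolding d_def by linarith
  qed
  have "\<beta> * cnj \<beta> + \<beta> * cnj \<gamma> + \<gamma> * cnj \<beta> + \<gamma> * cnj \<gamma> = (\<beta> + \<gamma>) * cnj (\<beta> + \<gamma>)"
    by (simp add: algebra_simps)
  also have "\<dots> = complex_of_real ((cmod (\<beta> + \<gamma>))\<^sup>2)"
    by (rule complex_norm_square[symmetric])
  finally have "Re (\<beta> * cnj \<beta>) + Re (\<beta> * cnj \<gamma>) + Re (\<gamma> * cnj \<beta>) + Re (\<gamma> * cnj \<gamma>) =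
      (cmod (\<beta> + \<gamma>))\<^sup>2"
    by (metis Re_complex_of_real plus_complex.sel(1))
  then have "0 \<le> Re (\<beta> * cnj \<beta>) + Re (\<beta> * cnj \<gamma>) + Re (\<gamma> * cnj \<beta>) + Re (\<gamma> * cnj \<gamma>)"
    by simp
  \<comment> \<open>The four errors together stay below \<open>4 * p * q * h ^ 4\<close>, which is
    exactly the excess of \<open>2 * (A + B)\<close> over 4.\<close>
  moreover have "r < p * q * h ^ 4"
    unfolding r_def C_def using e h by (intro mult_strict_right_mono) auto
  moreover have "A + B = 2 + 2 * (p * q * h ^ 4)"
    by (simp add: A B power2_eq_square power4_eq_xxxx algebra_simps)
  ultimately show ?thesis
    using bound[OF AB(1-3) \<beta> \<beta>] bound[OF AB(4-6) \<beta> \<gamma>] bound[OF AB(4-6) \<gamma> \<beta>]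
      bound[OF AB(1-3) \<gamma> \<gamma>]
    unfolding plus_complex.sel by linarith
qed

section \<open>The polydisc, the value at its centre, and a direction killed by the
  derivative\<close>

lemma polydisc_vimage: "polydisc = (\<Inter>i. (\<lambda>z. z $ i) -` ball 0 1)"
  by (auto simp: polydisc_def)

lemma open_polydisc: "open (polydisc :: (complex ^ 'n::finite) set)"
  unfolding polydisc_vimage by (intro open_INT ballI open_vimage continuous_intros) auto

lemma convex_polydisc: "convex (polydisc :: (complex ^ 'n::finite) set)"
  unfolding polydisc_vimage
  by (intro convex_INT convex_linear_vimage bounded_linear.linear bounded_linear_vec_nth convex_ball)

lemma bounded_linear_vector_line: "bounded_linear (\<lambda>t. t *s (z :: complex ^ 'n::finite))"
  by (intro linear_conv_bounded_linear[THEN iffD1] linearI)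
    (simp_all add: Finite_Cartesian_Product.vec_eq_iff algebra_simps)

text \<open>If the modulus reached 1 at the origin, the one-variable maximum principle on the slice
  \<open>t \<mapsto> t *s z\<close> would give \<open>\<phi> z = \<phi> 0\<close> for each
  \<open>z\<close>. The slice domain is convex, hence connected, and contains both 0 and 1.\<close>

lemma H_infinity_ball_center_less_one:
  fixes \<phi> :: "complex ^ 'n::finite \<Rightarrow> complex"
  assumes \<phi>: "\<phi> \<in> H_infinity_ball" and nc: "\<not> \<phi> constant_on polydisc"
  shows "cmod (\<phi> 0) < 1"
proof (rule ccontr)
  assume "\<not> cmod (\<phi> 0) < 1"
  have "\<phi> z = \<phi> 0" if z: "z \<in> polydisc" for z
  proof -
    define U where "U = (\<lambda>t. t *s z) -` polydisc"
    have U: "open U" "convex U"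
      unfolding U_def using open_polydisc convex_polydisc bounded_linear_vector_line[of z]
      by (auto intro!: open_vimage convex_linear_vimage bounded_linear.linear
          linear_continuous_on)
    have "(\<lambda>t. \<phi> (t *s z)) holomorphic_on U"
      unfolding holomorphic_on_def
    proof
      fix t assume "t \<in> U"
      then obtain D where D: "(\<phi> has_derivative D) (at (t *s z))" "\<And>c v. D (c *s v) = c * D v"
        using \<phi> by (auto simp: U_def H_infinity_ball_def holomorphic_multi_def)
      have "((\<lambda>t. \<phi> (t *s z)) has_derivative (\<lambda>s. D (s *s z))) (at t)"
        using has_derivative_compose[OF
            bounded_linear_imp_has_derivative[OF bounded_linear_vector_line] D(1)] .
      \<comment> \<open>Complex linearity of \<open>D\<close> turns the real derivative along the
        slice into a complex one.\<close>
      then have "((\<lambda>t. \<phi> (t *s z)) has_field_derivative D z) (at t)"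
        by (simp add: D(2) has_field_derivative_def mult.commute[of _ "D z"])
      then show "(\<lambda>t. \<phi> (t *s z)) field_differentiable at t within U"
        unfolding field_differentiable_def using has_field_derivative_at_within by blast
    qed
    moreover have U01: "0 \<in> U" "1 \<in> U" using z by (simp_all add: U_def polydisc_def)
    moreover have "cmod (\<phi> (t *s z)) \<le> cmod (\<phi> (0 *s z))" if "t \<in> U" for t
    proof -
      have "cmod (\<phi> (t *s z)) \<le> 1"
        using that \<phi> by (simp add: U_def H_infinity_ball_def)
      then show ?thesis using \<open>\<not> cmod (\<phi> 0) < 1\<close> by simp
    qed
    ultimately have "(\<lambda>t. \<phi> (t *s z)) constant_on U"
      using U by (intro maximum_modulus_principle[where U=U and \<xi>=0] convex_connected) auto
    then have "\<phi> (1 *s z) = \<phi> (0 *s z)" using U01 unfolding constant_on_def by metis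
    then show ?thesis by simp
  qed
  then show False using nc by (auto simp: constant_on_def)
qed

text \<open>Pigeonhole: among three coordinate vectors, \<open>D\<close> either vanishes on two,
  whose sum then works, or is nonzero on two, whose values can be played off against each
  other.\<close>

lemma linear_functional_kernel_direction:
  fixes D :: "complex ^ 'n::finite \<Rightarrow> complex"
  assumes card: "CARD('n) \<ge> 3" and add: "\<And>v w. D (v + w) = D v + D w"
    and scale: "\<And>c v. D (c *s v) = c * D v"
  obtains i j x y where "i \<noteq> j" "x \<noteq> 0" "y \<noteq> 0" "D (x *s axis i 1 + y *s axis j 1) = 0"
proof -
  note direction = that
  obtain T :: "'n set" where "card T = 3"
    using obtain_subset_with_card_n[OF card] by blast
  then obtain i j k :: 'n where ijk: "i \<noteq> j" "i \<noteq> k" "j \<noteq> k"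
    by (auto simp: card_3_iff)
  have zero: thesis if "m \<noteq> l" "D (axis m 1) = 0" "D (axis l 1) = 0" for m l
    using that by (intro direction[of m l 1 1]) (simp_all add: add scale)
  have nonzero: thesis if "m \<noteq> l" "D (axis m 1) \<noteq> 0" "D (axis l 1) \<noteq> 0" for m l
    using that by (intro direction[of m l "D (axis l 1)" "- D (axis m 1)"]) (simp_all only: add scale, simp_all)
  show thesis using zero nonzero ijk by metis
qed

section \<open>Kernel formulas on a line and after the Moebius map\<close>

lemma szego_kernel_two_coordinates:
  fixes s t x y :: complex and i j :: "'n::finite"
  assumes "i \<noteq> j"
  defines "v \<equiv> x *s axis i 1 + y *s axis j 1"
  shows "szego_kernel (s *s v) (t *s v) =
    1 / ((1 - complex_of_real ((cmod x)\<^sup>2) * (s * cnj t)) *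
         (1 - complex_of_real ((cmod y)\<^sup>2) * (s * cnj t)))"
proof -
  have v: "v $ k = (if k = i then x else if k = j then y else 0)" for k
    using assms by (simp add: v_def axis_def)
  have "(\<Prod>k\<in>UNIV. 1 - (s *s v) $ k * cnj ((t *s v) $ k)) =
      (\<Prod>k\<in>{i, j}. 1 - (s *s v) $ k * cnj ((t *s v) $ k))"
    by (intro prod.mono_neutral_right) (auto simp: v)
  also have "\<dots> = (1 - x * cnj x * (s * cnj t)) * (1 - y * cnj y * (s * cnj t))"
    using \<open>i \<noteq> j\<close> by (simp add: v algebra_simps)
  finally show ?thesis
    by (simp only: szego_kernel_def complex_norm_square)
qed

text \<open>Serves to normalise the kernel at the origin: for \<open>f = \<phi> z\<close>,
  \<open>g = \<phi> w\<close>, \<open>c = \<phi> 0\<close>, the reciprocal of the right side is what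
  \<open>\<phi>\<close> contributes to \<open>K z 0 * K 0 w / (K 0 0 * K z w)\<close>.\<close>

lemma one_minus_moebius_mult_cnj:
  fixes c f g :: complex
  assumes f: "1 - f * cnj c \<noteq> 0" and g: "1 - g * cnj c \<noteq> 0"
  shows "1 - (f - c) / (1 - f * cnj c) * cnj ((g - c) / (1 - g * cnj c)) =
    (1 - c * cnj c) * (1 - f * cnj g) / ((1 - f * cnj c) * (1 - c * cnj g))"
proof -
  have "1 - c * cnj g \<noteq> 0"
    using g by (metis complex_cnj_cnj complex_cnj_diff complex_cnj_mult complex_cnj_one
        complex_cnj_zero_iff mult.commute)
  then show ?thesis using f by (simp add: divide_simps mult.commute) (simp add: algebra_simps)
qed

section \<open>Choice of the points and the contradiction\<close>

theorem corollary4p4: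
  assumes "CARD('n::finite) \<ge> 3"
  shows "\<not> (\<exists>\<phi> :: complex ^ 'n \<Rightarrow> complex.
            \<phi> \<in> H_infinity_ball \<and> \<not> \<phi> constant_on polydisc \<and>
            (\<exists>H ip. cnp_space polydisc H ip (dbr_kernel \<phi>)))"
proof (rule notI, elim exE conjE)
  fix \<phi> :: "complex ^ 'n \<Rightarrow> complex" and H ip
  assume \<phi>: "\<phi> \<in> H_infinity_ball" and nc: "\<not> \<phi> constant_on polydisc"
    and cnp: "cnp_space polydisc H ip (dbr_kernel \<phi>)"
  define c where "c = \<phi> 0"
  have c: "cmod c < 1"
    unfolding c_def using \<phi> nc by (rule H_infinity_ball_center_less_one)
  have "0 \<in> polydisc" by (simp add: polydisc_def)
  then obtain D where D: "(\<phi> has_derivative D) (at 0)" and scale: "\<And>c v. D (c *s v) = c * D v"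
    using \<phi> by (auto simp: H_infinity_ball_def holomorphic_multi_def)
  obtain i j x y where ij: "i \<noteq> j" and xy: "x \<noteq> 0" "y \<noteq> 0"
    and Dv: "D (x *s axis i 1 + y *s axis j 1) = 0"
    using linear_functional_kernel_direction[OF assms linear_add[OF has_derivative_linear[OF D]] scale]
    by blast
  define v where "v = x *s axis i 1 + y *s axis j 1"
  have "v $ i = x" using ij by (simp add: v_def axis_def)
  then have v: "v \<noteq> 0" using xy by auto
  define p q where "p = (cmod x)\<^sup>2" and "q = (cmod y)\<^sup>2"
  have pq: "0 < p" "0 < q" "0 < p * q" using xy by (simp_all add: p_def q_def)
  define C where "C = p + q + p * q + 8"
  have C: "C > 0" unfolding C_def using pq by linarith
  \<comment> \<open>Both bounds together give \<open>C * e\<^sup>2 \<le> p * q / 2\<close>, the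
    smallness that \<open>four_point_sum_gt\<close> requires.\<close>
  define e where "e = min (1 / 2) (p * q / C)"
  have e: "0 < e" "e \<le> 1 / 2" using divide_pos_pos[OF pq(3) C] unfolding e_def by linarith+
  have "C * e\<^sup>2 \<le> (C * e) * (1 / 2)"
    using e C by (simp add: power2_eq_square)
  moreover have "C * e \<le> p * q"
    using C by (simp add: e_def min_def field_simps)
  ultimately have eC: "C * e\<^sup>2 < p * q" using pq by linarith
  \<comment> \<open>The tolerance anticipates two later losses: the Moebius denominator is only
    known to be at least \<open>1 - cmod c\<close>, and the points have norm
    \<open>h * norm v\<close>.\<close>
  have "0 < e * (1 - cmod c) / norm v" using e c v by simp
  then obtain d where d: "d > 0"
    and approx: "\<And>z. norm z < d \<Longrightarrow> cmod (\<phi> z - c - D z) \<le> e * (1 - cmod c) / norm v * norm z"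
    using D unfolding has_derivative_at_alt c_def by (metis diff_zero)
  define N where "N = 1 + p + q + norm v"
  have N: "0 < N" unfolding N_def using pq norm_ge_zero[of v] by linarith
  \<comment> \<open>One choice makes \<open>h\<close>, \<open>p * h\<close>, \<open>q * h\<close>
    and \<open>h * norm v\<close> small at once: they add up to \<open>h * N\<close>, which is half
    of \<open>min d 1\<close>.\<close>
  define h where "h = min d 1 / (2 * N)"
  have h0: "0 < h" using d N by (simp add: h_def)
  have "h * N = min d 1 / 2" using N by (simp add: h_def)
  then have "h + p * h + q * h + h * norm v = min d 1 / 2"
    by (simp add: N_def algebra_simps)
  moreover have "0 < p * h" "0 < q * h" "0 \<le> h * norm v" using h0 pq by simp_all
  moreover have "0 < min d 1" "min d 1 \<le> d" "min d 1 \<le> 1" using d by simp_all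
  ultimately have h: "h < 1" "p * h < 1" "q * h < 1" "h * norm v < d" "h * norm v < 1"
    using h0 by linarith+
  have ph: "r * h\<^sup>2 < 1" if "0 < r" "r * h < 1" for r
  proof -
    have "r * h\<^sup>2 = r * h * h" by (simp add: power2_eq_square)
    also have "\<dots> \<le> r * h * 1" using h h0 that by (intro mult_left_mono) auto
    finally show ?thesis using that by linarith
  qed
  define A B where "A = (1 - p * h\<^sup>2) * (1 - q * h\<^sup>2)" and "B = (1 + p * h\<^sup>2) * (1 + q * h\<^sup>2)"
  have AB: "0 < A" "0 < B"
    using ph[OF pq(1) h(2)] ph[OF pq(2) h(3)] pq h0 by (simp_all add: A_def B_def add_pos_pos)
  define X Y where "X = complex_of_real h *s v" and "Y = complex_of_real (- h) *s v"
  define \<beta> where "\<beta> = (\<lambda>z. (\<phi> z - c) / (1 - \<phi> z * cnj c))"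
  have normXY: "norm z = h * norm v" if "z = X \<or> z = Y" for z
  proof -
    have "complex_of_real r *s v = r *\<^sub>R v" for r
      by (simp add: Finite_Cartesian_Product.vec_eq_iff scaleR_conv_of_real[where 'a = complex])
    then show ?thesis using that h0 by (auto simp: X_def Y_def simp del: of_real_minus)
  qed
  have mem: "z \<in> polydisc" if "z = X \<or> z = Y" for z
    unfolding polydisc_def
    using le_less_trans[OF Finite_Cartesian_Product.norm_nth_le[of z]] normXY[OF that] h(5) by simp
  have le1: "cmod (\<phi> z) \<le> 1" if "z = X \<or> z = Y" for z
    using mem[OF that] \<phi> by (simp add: H_infinity_ball_def)
  have denom: "1 - cmod c \<le> cmod (1 - \<phi> z * cnj c)" if "z = X \<or> z = Y" for z
  proof -
    have "cmod (\<phi> z * cnj c) \<le> 1 * cmod c"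
      unfolding norm_mult complex_mod_cnj using le1[OF that] by (intro mult_right_mono) auto
    then show ?thesis using norm_triangle_ineq2[of 1 "\<phi> z * cnj c"] by simp
  qed
  have denom0: "1 - \<phi> z * cnj c \<noteq> 0" if "z = X \<or> z = Y" for z
    using denom[OF that] c by auto
  have \<beta>: "cmod (\<beta> z) \<le> e * h" if z: "z = X \<or> z = Y" for z
  proof -
    \<comment> \<open>Both points are multiples of \<open>v\<close>, so the linear term drops out
      and \<open>\<phi> z - c\<close> is pure remainder.\<close>
    have "D z = 0" using z scale Dv unfolding X_def Y_def v_def[symmetric] by (metis mult_zero_right)
    then have "cmod (\<phi> z - c) \<le> e * h * (1 - cmod c)"
      using approx[of z] normXY[OF z] h(4) v by (simp add: mult_ac)
    also have "\<dots> \<le> e * h * cmod (1 - \<phi> z * cnj c)"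
      using denom[OF z] e h0 by (intro mult_left_mono) auto
    finally show ?thesis
      using denom0[OF z] by (simp add: \<beta>_def norm_divide divide_le_eq)
  qed
  have eh: "e * h \<le> 1 / 2"
    using mult_mono[of e "1/2" h 1] e h h0 by simp
  note moebius = one_minus_moebius_mult_cnj[OF denom0 denom0, folded \<beta>_def]
  \<comment> \<open>A value of modulus 1 would be moved by the Moebius map to modulus 1, against the
    bound on \<open>\<beta>\<close>. Strictness makes the kernel positive at \<open>(X, X)\<close>
    and \<open>(Y, Y)\<close> and nonzero at \<open>(X, Y)\<close>.\<close>
  have less1: "cmod (\<phi> z) < 1" if z: "z = X \<or> z = Y" for z
  proof (rule ccontr)
    assume "\<not> cmod (\<phi> z) < 1"
    then have "\<phi> z * cnj (\<phi> z) = 1"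
      using le1[OF z] by (simp flip: complex_norm_square)
    then have "\<beta> z * cnj (\<beta> z) = 1" using moebius[OF z z] by (simp add: \<beta>_def)
    then have "(cmod (\<beta> z))\<^sup>2 = 1"
      by (metis complex_norm_square of_real_eq_1_iff)
    then have "cmod (\<beta> z) = 1" by (simp add: power2_eq_1_iff) (use norm_ge_zero[of "\<beta> z"] in linarith)
    then show False using \<beta>[OF z] eh by simp
  qed
  \<comment> \<open>The reciprocal of the Szego kernel on \<open>{X, Y}\<close>: the product of the
    line parameters is \<open>h\<^sup>2\<close> for equal points and its negative otherwise.\<close>
  define P where "P = (\<lambda>z w :: complex ^ 'n. if z = w then A else B)"
  have "h \<noteq> 0" using h0 by simp
  then have XY: "X \<noteq> Y"
    using v by (auto simp: X_def Y_def Finite_Cartesian_Product.vec_eq_iff)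
  have line: "szego_kernel (complex_of_real s *s v) (complex_of_real t *s v) =
      1 / complex_of_real ((1 - p * (s * t)) * (1 - q * (s * t)))" for s t :: real
    using szego_kernel_two_coordinates[OF ij, of "complex_of_real s" x y "complex_of_real t"]
    by (simp add: v_def p_def q_def)
  have szego: "szego_kernel z w = 1 / complex_of_real (P z w)"
    if "z = X \<or> z = Y" "w = X \<or> w = Y" for z w
    using that XY line[of h h, folded X_def Y_def] line[of h "- h", folded X_def Y_def]
      line[of "- h" h, folded X_def Y_def] line[of "- h" "- h", folded X_def Y_def]
    by (auto simp: P_def A_def B_def power2_eq_square)
  have P0: "P z w > 0" for z w using AB by (simp add: P_def)
  have szego0: "szego_kernel z 0 = 1" "szego_kernel 0 z = 1" for z :: "complex ^ 'n"
    by (simp_all add: szego_kernel_def)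
  let ?K = "dbr_kernel \<phi>"
  define L where "L = (\<lambda>z w. 1 - ?K z 0 * ?K 0 w / (?K 0 0 * ?K z w))"
  have L: "L z w = 1 - complex_of_real (P z w) / (1 - \<beta> z * cnj (\<beta> w))"
    if z: "z = X \<or> z = Y" and w: "w = X \<or> w = Y" for z w
    using szego[OF z w] moebius[OF z w]
    by (simp add: L_def dbr_kernel_def szego0 \<beta>_def flip: c_def)
  have diag: "Re (?K z z) = (1 - (cmod (\<phi> z))\<^sup>2) * Re (szego_kernel z z)"
    if "Im (szego_kernel z z) = 0" for z
    using that by (simp add: dbr_kernel_def flip: complex_norm_square)
  have "0 \<le> Re (L X X + L X Y + L Y X + L Y Y)"
  proof (rule cnp_three_points[OF cnp \<open>0 \<in> polydisc\<close> mem mem XY])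
    show "0 < Re (?K 0 0)"
      using c by (simp add: diag szego0 power_less_one_iff abs_square_less_1 flip: c_def)
    show "0 < Re (?K X X)" "0 < Re (?K Y Y)"
      using less1[of X] less1[of Y] P0 by (simp_all add: diag szego abs_square_less_1)
    have "cmod (\<phi> X * cnj (\<phi> Y)) < 1"
      using mult_strict_mono[of "cmod (\<phi> X)" 1 "cmod (\<phi> Y)" 1] less1 by (simp add: norm_mult)
    then have "1 - \<phi> X * cnj (\<phi> Y) \<noteq> 0" by auto
    then show "?K X Y \<noteq> 0" using P0[of X Y] by (simp add: dbr_kernel_def szego)
  qed (simp_all add: L_def)
  \<comment> \<open>The four entries of \<open>L\<close> add up to 4 minus this sum, so their real
    part would be negative.\<close>
  moreover have "4 < Re (of_real A / (1 - \<beta> X * cnj (\<beta> X)) + of_real B / (1 - \<beta> X * cnj (\<beta> Y))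
    + of_real B / (1 - \<beta> Y * cnj (\<beta> X)) + of_real A / (1 - \<beta> Y * cnj (\<beta> Y)))"
    using pq h0 h e eC[unfolded C_def] \<beta> ph[OF pq(1) h(2)] ph[OF pq(2) h(3)] A_def B_def
    by (intro four_point_sum_gt[of p q h e]) auto
  ultimately show False
    using XY by (simp add: L P_def)
qed

end
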